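(* Let $(A,\dashv,\perp,\vdash)$ be a triassociative algebra over a field $\mathbb{K}$ and let $I$ be a two-sided ideal of $A$. Then the quotient vector space $A/I$ is a triassociative algebra with the (well-defined) products $$\overline{x}\,\overline{\dashv}\,\overline{y}:=(x\dashv y)+I,\qquad \overline{x}\,\overline{\perp}\,\overline{y}:=(x\perp y)+I,\qquad \overline{x}\,\overline{\vdash}\,\overline{y}:=(x\vdash y)+I,$$ for all $\overline{x},\overline{y}\in A/I$, where $\overline{x}=x+I$.
   Context: A triassociative algebra over $\mathbb{K}$ is a $\mathbb{K}$-vector space $A$ with three bilinear maps $\dashv,\perp,\vdash:A\times A\to A$ such that for all $x,y,z\in A$: (1) $(x\dashv y)\dashv z=x\dashv(y\dashv z)$; (2) $(x\vdash y)\vdash z=x\vdash(y\vdash z)$; (3) $(x\perp y)\perp z=x\perp(y\perp z)$; (4) $(x\dashv y)\dashv z=x\dashv(y\vdash z)$; (5) $(x\dashv y)\dashv z=x\dashv(y\perp z)$; (6) $(x\vdash y)\dashv z=x\vdash(y\dashv z)$; (7) $(x\dashv y)\vdash z=x\vdash(y\vdash z)$; (8) $(x\perp y)\vdash z=x\vdash(y\vdash z)$; (9) $(x\perp y)\dashv z=x\perp(y\dashv z)$; (10) $(x\dashv y)\perp z=x\perp(y\vdash z)$; (11) $(x\vdash y)\perp z=x\vdash(y\perp z)$. A subalgebra of $A$ is a linear subspace stable under the three products. A two-sided ideal of $A$ is a subalgebra $I$ such that $x\ast y\in I$ and $y\ast x\in I$ for all $x\in A$, $y\in I$, $\ast\in\{\dashv,\perp,\vdash\}$.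 *)

theory Defs
  imports "HOL-Algebra.Module" "HOL-Algebra.AbelCoset"
begin

text \<open>
  The record \<open>module\<close> of HOL-Algebra extends \<open>ring\<close>; its fields \<open>mult\<close> and \<open>one\<close> have no
  meaning for a vector space and are left unconstrained. Only the values of the three
  products on the carrier matter.
\<close>

record ('k, 'a) trialgebra = "('k, 'a) module" +
  lprod :: "'a \<Rightarrow> 'a \<Rightarrow> 'a" (infixl "\<stileturn>\<index>" 70)
  mprod :: "'a \<Rightarrow> 'a \<Rightarrow> 'a" (infixl "\<bottom>\<index>" 70)
  rprod :: "'a \<Rightarrow> 'a \<Rightarrow> 'a" (infixl "\<turnstile>\<index>" 70)

definition bilinear_op ::
    "('k, 'r) ring_scheme \<Rightarrow> ('k, 'a, 'm) module_scheme \<Rightarrow> ('a \<Rightarrow> 'a \<Rightarrow> 'a) \<Rightarrow> bool" where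
  "bilinear_op K A f \<longleftrightarrow>
     (\<forall>x\<in>carrier A. \<forall>y\<in>carrier A. f x y \<in> carrier A) \<and>
     (\<forall>x\<in>carrier A. \<forall>y\<in>carrier A. \<forall>z\<in>carrier A.
        f (x \<oplus>\<^bsub>A\<^esub> y) z = f x z \<oplus>\<^bsub>A\<^esub> f y z \<and>
        f x (y \<oplus>\<^bsub>A\<^esub> z) = f x y \<oplus>\<^bsub>A\<^esub> f x z) \<and>
     (\<forall>a\<in>carrier K. \<forall>x\<in>carrier A. \<forall>y\<in>carrier A.
        f (a \<odot>\<^bsub>A\<^esub> x) y = a \<odot>\<^bsub>A\<^esub> f x y \<and>
        f x (a \<odot>\<^bsub>A\<^esub> y) = a \<odot>\<^bsub>A\<^esub> f x y)"

text \<open>A \<open>K\<close>-vector space is a HOL-Algebra module over the field \<open>K\<close>.\<close>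

locale triassociative_algebra = K?: field K + module K A
  for K (structure) and A (structure) +
  assumes bilinear_lprod: "bilinear_op K A (\<stileturn>\<^bsub>A\<^esub>)"
    and bilinear_mprod: "bilinear_op K A (\<bottom>\<^bsub>A\<^esub>)"
    and bilinear_rprod: "bilinear_op K A (\<turnstile>\<^bsub>A\<^esub>)"
    and tri1: "\<lbrakk>x \<in> carrier A; y \<in> carrier A; z \<in> carrier A\<rbrakk> \<Longrightarrow>
      (x \<stileturn>\<^bsub>A\<^esub> y) \<stileturn>\<^bsub>A\<^esub> z = x \<stileturn>\<^bsub>A\<^esub> (y \<stileturn>\<^bsub>A\<^esub> z)"
    and tri2: "\<lbrakk>x \<in> carrier A; y \<in> carrier A; z \<in> carrier A\<rbrakk> \<Longrightarrow>
      (x \<turnstile>\<^bsub>A\<^esub> y) \<turnstile>\<^bsub>A\<^esub> z = x \<turnstile>\<^bsub>A\<^esub> (y \<turnstile>\<^bsub>A\<^esub> z)"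
    and tri3: "\<lbrakk>x \<in> carrier A; y \<in> carrier A; z \<in> carrier A\<rbrakk> \<Longrightarrow>
      (x \<bottom>\<^bsub>A\<^esub> y) \<bottom>\<^bsub>A\<^esub> z = x \<bottom>\<^bsub>A\<^esub> (y \<bottom>\<^bsub>A\<^esub> z)"
    and tri4: "\<lbrakk>x \<in> carrier A; y \<in> carrier A; z \<in> carrier A\<rbrakk> \<Longrightarrow>
      (x \<stileturn>\<^bsub>A\<^esub> y) \<stileturn>\<^bsub>A\<^esub> z = x \<stileturn>\<^bsub>A\<^esub> (y \<turnstile>\<^bsub>A\<^esub> z)"
    and tri5: "\<lbrakk>x \<in> carrier A; y \<in> carrier A; z \<in> carrier A\<rbrakk> \<Longrightarrow>
      (x \<stileturn>\<^bsub>A\<^esub> y) \<stileturn>\<^bsub>A\<^esub> z = x \<stileturn>\<^bsub>A\<^esub> (y \<bottom>\<^bsub>A\<^esub> z)"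
    and tri6: "\<lbrakk>x \<in> carrier A; y \<in> carrier A; z \<in> carrier A\<rbrakk> \<Longrightarrow>
      (x \<turnstile>\<^bsub>A\<^esub> y) \<stileturn>\<^bsub>A\<^esub> z = x \<turnstile>\<^bsub>A\<^esub> (y \<stileturn>\<^bsub>A\<^esub> z)"
    and tri7: "\<lbrakk>x \<in> carrier A; y \<in> carrier A; z \<in> carrier A\<rbrakk> \<Longrightarrow>
      (x \<stileturn>\<^bsub>A\<^esub> y) \<turnstile>\<^bsub>A\<^esub> z = x \<turnstile>\<^bsub>A\<^esub> (y \<turnstile>\<^bsub>A\<^esub> z)"
    and tri8: "\<lbrakk>x \<in> carrier A; y \<in> carrier A; z \<in> carrier A\<rbrakk> \<Longrightarrow>
      (x \<bottom>\<^bsub>A\<^esub> y) \<turnstile>\<^bsub>A\<^esub> z = x \<turnstile>\<^bsub>A\<^esub> (y \<turnstile>\<^bsub>A\<^esub> z)"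
    and tri9: "\<lbrakk>x \<in> carrier A; y \<in> carrier A; z \<in> carrier A\<rbrakk> \<Longrightarrow>
      (x \<bottom>\<^bsub>A\<^esub> y) \<stileturn>\<^bsub>A\<^esub> z = x \<bottom>\<^bsub>A\<^esub> (y \<stileturn>\<^bsub>A\<^esub> z)"
    and tri10: "\<lbrakk>x \<in> carrier A; y \<in> carrier A; z \<in> carrier A\<rbrakk> \<Longrightarrow>
      (x \<stileturn>\<^bsub>A\<^esub> y) \<bottom>\<^bsub>A\<^esub> z = x \<bottom>\<^bsub>A\<^esub> (y \<turnstile>\<^bsub>A\<^esub> z)"
    and tri11: "\<lbrakk>x \<in> carrier A; y \<in> carrier A; z \<in> carrier A\<rbrakk> \<Longrightarrow>
      (x \<turnstile>\<^bsub>A\<^esub> y) \<bottom>\<^bsub>A\<^esub> z = x \<turnstile>\<^bsub>A\<^esub> (y \<bottom>\<^bsub>A\<^esub> z)"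

locale tri_subalgebra = submodule I K A for I and K (structure) and A (structure) +
  assumes lprod_closed: "\<lbrakk>x \<in> I; y \<in> I\<rbrakk> \<Longrightarrow> x \<stileturn>\<^bsub>A\<^esub> y \<in> I"
    and mprod_closed: "\<lbrakk>x \<in> I; y \<in> I\<rbrakk> \<Longrightarrow> x \<bottom>\<^bsub>A\<^esub> y \<in> I"
    and rprod_closed: "\<lbrakk>x \<in> I; y \<in> I\<rbrakk> \<Longrightarrow> x \<turnstile>\<^bsub>A\<^esub> y \<in> I"

locale tri_ideal = tri_subalgebra I K A for I and K (structure) and A (structure) +
  assumes lprod_absorb: "\<lbrakk>x \<in> carrier A; y \<in> I\<rbrakk> \<Longrightarrow> x \<stileturn>\<^bsub>A\<^esub> y \<in> I \<and> y \<stileturn>\<^bsub>A\<^esub> x \<in> I"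
    and mprod_absorb: "\<lbrakk>x \<in> carrier A; y \<in> I\<rbrakk> \<Longrightarrow> x \<bottom>\<^bsub>A\<^esub> y \<in> I \<and> y \<bottom>\<^bsub>A\<^esub> x \<in> I"
    and rprod_absorb: "\<lbrakk>x \<in> carrier A; y \<in> I\<rbrakk> \<Longrightarrow> x \<turnstile>\<^bsub>A\<^esub> y \<in> I \<and> y \<turnstile>\<^bsub>A\<^esub> x \<in> I"

text \<open>
  An operation on \<open>A\<close> is carried over to cosets as in \<open>rcoset_mult\<close>, by taking the union
  of the result cosets over all representatives. This union is itself a coset precisely when
  the result does not depend on the representatives. The pointwise image would not do: for
  instance \<open>0 \<odot> X\<close> would be \<open>{0}\<close> instead of \<open>I\<close>.
\<close>

definition coset_op :: "('a, 'm) ring_scheme \<Rightarrow> 'a set \<Rightarrow> ('a \<Rightarrow> 'a \<Rightarrow> 'a) \<Rightarrow> 'a set \<Rightarrow> 'a set \<Rightarrow> 'a set"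
  where "coset_op A I f X Y = (\<Union>x\<in>X. \<Union>y\<in>Y. I +>\<^bsub>A\<^esub> f x y)"

definition quotient_trialgebra ::
    "('k, 'a, 'm) trialgebra_scheme \<Rightarrow> 'a set \<Rightarrow> ('k, 'a set) trialgebra" where
  "quotient_trialgebra A I =
     \<lparr>carrier = a_rcosets\<^bsub>A\<^esub> I, mult = undefined, one = undefined,
      zero = I, add = set_add A,
      smult = (\<lambda>a X. \<Union>x\<in>X. I +>\<^bsub>A\<^esub> (a \<odot>\<^bsub>A\<^esub> x)),
      lprod = coset_op A I (\<stileturn>\<^bsub>A\<^esub>),
      mprod = coset_op A I (\<bottom>\<^bsub>A\<^esub>),
      rprod = coset_op A I (\<turnstile>\<^bsub>A\<^esub>)\<rparr>"

end

theory Submission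
  imports Defs
begin

text \<open>
  The coset map \<open>x \<mapsto> I + x\<close> is onto and carries addition, scalar multiplication and each of the
  three products of \<open>A\<close> to the corresponding operation of the quotient. For the products this rests
  on \<open>f (h + x) (k + y) = f h (k + y) + f x k + f x y\<close>, whose first two summands lie in the ideal
  when \<open>h\<close> and \<open>k\<close> do. Every identity of the quotient is therefore the image of an identity of \<open>A\<close>.
\<close>

lemma (in abelian_subgroup) a_rcosE:
  assumes "x' \<in> H +> x"
  obtains h where "h \<in> H" "x' = h \<oplus> x"
  using assms by (auto simp: a_r_coset_def')

lemma (in abelian_subgroup) a_rcos_add_absorb:
  assumes "h \<in> H" "x \<in> carrier G"
  shows "H +> (h \<oplus> x) = H +> x"
  using a_repr_independence'[OF a_rcosI] assms a_subset by simp

lemma (in abelian_subgroup) biadditive_rcos_cong: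
  assumes closed: "\<And>x y. \<lbrakk>x \<in> carrier G; y \<in> carrier G\<rbrakk> \<Longrightarrow> f x y \<in> carrier G"
    and add_left: "\<And>x y z. \<lbrakk>x \<in> carrier G; y \<in> carrier G; z \<in> carrier G\<rbrakk> \<Longrightarrow>
      f (x \<oplus> y) z = f x z \<oplus> f y z"
    and add_right: "\<And>x y z. \<lbrakk>x \<in> carrier G; y \<in> carrier G; z \<in> carrier G\<rbrakk> \<Longrightarrow>
      f x (y \<oplus> z) = f x y \<oplus> f x z"
    and absorb: "\<And>x y. \<lbrakk>x \<in> carrier G; y \<in> H\<rbrakk> \<Longrightarrow> f x y \<in> H \<and> f y x \<in> H"
    and x: "x \<in> carrier G" "x' \<in> H +> x"
    and y: "y \<in> carrier G" "y' \<in> H +> y"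
  shows "H +> f x' y' = H +> f x y"
proof -
  obtain h where h: "h \<in> H" "x' = h \<oplus> x" using x(2) by (rule a_rcosE)
  obtain k where k: "k \<in> H" "y' = k \<oplus> y" using y(2) by (rule a_rcosE)
  have y': "y' \<in> carrier G" using k y by simp
  \<comment> \<open>The arguments are exchanged one at a time: \<open>f h y'\<close> is absorbed
    while \<open>y'\<close> is still intact, then \<open>f x k\<close> once \<open>x\<close> is in
    place.\<close>
  have "H +> f x' y' = H +> (f h y' \<oplus> f x y')"
    using h x y' by (simp add: add_left)
  also have "\<dots> = H +> f x y'"
    using absorb h x y' by (simp add: a_rcos_add_absorb closed)
  also have "\<dots> = H +> (f x k \<oplus> f x y)"
    using k x y by (simp add: add_right)
  also have "\<dots> = H +> f x y"
    using absorb k x y by (simp add: a_rcos_add_absorb closed)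
  finally show ?thesis .
qed

text \<open>The coset contains \<open>x\<close>, so the union is not empty and collapses to the
  common value. This evaluates scalar multiplication and the products of the quotient, both defined
  as unions over representatives.\<close>

lemma (in abelian_subgroup) UN_rcos_const:
  assumes "x \<in> carrier G"
    and "\<And>x'. x' \<in> H +> x \<Longrightarrow> g x' = S"
  shows "(\<Union>x'\<in>H +> x. g x') = S"
  using assms a_rcos_self[of x] by blast

text \<open>Opens the coset calculus for submodules; normality comes from the commutativity of
  addition.\<close>

lemma submodule_imp_abelian_subgroup:
  assumes "module K A" "submodule I K A"
  shows "abelian_subgroup I A"
  using assms
  by (auto intro: abelian_subgroupI3 additive_subgroupI simp: module_def submodule_def)

text \<open>The products are left unapplied so that they are also rewritten as arguments of
  \<open>bilinear_op\<close>.\<close>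

lemma quotient_trialgebra_simps:
  "carrier (quotient_trialgebra A I) = a_rcosets\<^bsub>A\<^esub> I"
  "\<zero>\<^bsub>quotient_trialgebra A I\<^esub> = I"
  "X \<oplus>\<^bsub>quotient_trialgebra A I\<^esub> Y = X <+>\<^bsub>A\<^esub> Y"
  "a \<odot>\<^bsub>quotient_trialgebra A I\<^esub> X = (\<Union>x\<in>X. I +>\<^bsub>A\<^esub> (a \<odot>\<^bsub>A\<^esub> x))"
  "(\<stileturn>\<^bsub>quotient_trialgebra A I\<^esub>) = coset_op A I (\<stileturn>\<^bsub>A\<^esub>)"
  "(\<bottom>\<^bsub>quotient_trialgebra A I\<^esub>) = coset_op A I (\<bottom>\<^bsub>A\<^esub>)"
  "(\<turnstile>\<^bsub>quotient_trialgebra A I\<^esub>) = coset_op A I (\<turnstile>\<^bsub>A\<^esub>)"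
  by (simp_all add: quotient_trialgebra_def)

text \<open>As an image of \<open>carrier A\<close>, the carrier turns quantifiers over cosets into
  quantifiers over representatives.\<close>

lemma carrier_quotient_trialgebra:
  "carrier (quotient_trialgebra A I) = (\<lambda>x. I +>\<^bsub>A\<^esub> x) ` carrier A"
  by (auto simp: quotient_trialgebra_simps A_RCOSETS_def')

lemma quotient_trialgebra_add:
  assumes "module K A" "submodule I K A" "x \<in> carrier A" "y \<in> carrier A"
  shows "(I +>\<^bsub>A\<^esub> x) \<oplus>\<^bsub>quotient_trialgebra A I\<^esub> (I +>\<^bsub>A\<^esub> y) = I +>\<^bsub>A\<^esub> (x \<oplus>\<^bsub>A\<^esub> y)"
  using abelian_subgroup.a_rcos_sum[OF submodule_imp_abelian_subgroup] assms
  by (simp add: quotient_trialgebra_simps)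

lemma quotient_trialgebra_smult:
  assumes "module K A" "submodule I K A" "a \<in> carrier K" "x \<in> carrier A"
  shows "a \<odot>\<^bsub>quotient_trialgebra A I\<^esub> (I +>\<^bsub>A\<^esub> x) = I +>\<^bsub>A\<^esub> (a \<odot>\<^bsub>A\<^esub> x)"
proof -
  interpret module K A by fact
  interpret submodule I K A by fact
  interpret S: abelian_subgroup I A
    using assms by (intro submodule_imp_abelian_subgroup)
  have "I +>\<^bsub>A\<^esub> (a \<odot>\<^bsub>A\<^esub> x') = I +>\<^bsub>A\<^esub> (a \<odot>\<^bsub>A\<^esub> x)" if "x' \<in> I +>\<^bsub>A\<^esub> x" for x'
    using that
  proof (rule S.a_rcosE)
    \<comment> \<open>Passing from \<open>x\<close> to \<open>x'\<close> adds the scalar multiple of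
      \<open>h\<close> by \<open>a\<close>, which stays in \<open>I\<close>.\<close>
    fix h assume "h \<in> I" "x' = h \<oplus>\<^bsub>A\<^esub> x"
    then show ?thesis
      using assms by (simp add: smult_r_distr S.a_rcos_add_absorb)
  qed
  then show ?thesis
    using assms unfolding quotient_trialgebra_simps by (intro S.UN_rcos_const)
qed

lemma module_quotient_trialgebra:
  assumes "module K A" "submodule I K A"
  shows "module K (quotient_trialgebra A I)"
proof -
  interpret module K A by fact
  interpret S: abelian_subgroup I A
    using assms by (intro submodule_imp_abelian_subgroup)
  \<comment> \<open>Writing the zero of the quotient as a coset makes
    \<open>quotient_trialgebra_add\<close> applicable to it.\<close>
  have I: "I +>\<^bsub>A\<^esub> \<zero>\<^bsub>A\<^esub> = I"
    by (simp add: S.a_rcos_const)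
  have "abelian_group (quotient_trialgebra A I)"
  proof (rule abelian_groupI)
    show "\<zero>\<^bsub>quotient_trialgebra A I\<^esub> \<in> carrier (quotient_trialgebra A I)"
      by (simp add: quotient_trialgebra_simps S.a_subgroup_in_rcosets)
  next
    fix X assume "X \<in> carrier (quotient_trialgebra A I)"
    then obtain x where x: "x \<in> carrier A" "X = I +>\<^bsub>A\<^esub> x"
      by (auto simp: carrier_quotient_trialgebra)
    show "\<zero>\<^bsub>quotient_trialgebra A I\<^esub> \<oplus>\<^bsub>quotient_trialgebra A I\<^esub> X = X"
      using quotient_trialgebra_add[OF assms M.zero_closed x(1)] x I
      by (simp add: quotient_trialgebra_simps(2))
    \<comment> \<open>The witness is the coset of the additive inverse of \<open>x\<close>.\<close>
    show "\<exists>Y\<in>carrier (quotient_trialgebra A I).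
        Y \<oplus>\<^bsub>quotient_trialgebra A I\<^esub> X = \<zero>\<^bsub>quotient_trialgebra A I\<^esub>"
      using quotient_trialgebra_add[OF assms M.a_inv_closed[OF x(1)] x(1)] x I
      by (auto simp: carrier_quotient_trialgebra quotient_trialgebra_simps(2) M.l_neg)
  \<comment> \<open>Closure, associativity and commutativity remain, each the image of the same law
    in \<open>A\<close>.\<close>
  qed (auto simp: carrier_quotient_trialgebra quotient_trialgebra_add[OF assms] M.a_ac)
  then show ?thesis
    by (intro moduleI is_cring)
      (auto simp: carrier_quotient_trialgebra quotient_trialgebra_add[OF assms]
        quotient_trialgebra_smult[OF assms] smult_l_distr smult_r_distr smult_assoc1)
qed

text \<open>Well-definedness and bilinearity use the same two properties of each product, so a
  single \<open>f\<close> stands for all three.\<close>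

locale ideal_op = module K A + submodule I K A
  for K (structure) and A :: "('k, 'a, 'm) trialgebra_scheme" (structure) and I +
  fixes f :: "'a \<Rightarrow> 'a \<Rightarrow> 'a"
  assumes bilinear: "bilinear_op K A f"
    and absorb: "\<lbrakk>x \<in> carrier A; y \<in> I\<rbrakk> \<Longrightarrow> f x y \<in> I \<and> f y x \<in> I"
begin

sublocale S: abelian_subgroup I A
  \<comment> \<open>\<open>K\<close> is given explicitly because the goal does not mention the
    scalars.\<close>
  by (intro submodule_imp_abelian_subgroup[of K]) unfold_locales

lemma op_closed: "\<lbrakk>x \<in> carrier A; y \<in> carrier A\<rbrakk> \<Longrightarrow> f x y \<in> carrier A"
  using bilinear by (simp add: bilinear_op_def)

lemma rcos_op_cong:
  assumes "x \<in> carrier A" "y \<in> carrier A" "x' \<in> I +>\<^bsub>A\<^esub> x" "y' \<in> I +>\<^bsub>A\<^esub> y"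
  shows "I +>\<^bsub>A\<^esub> f x' y' = I +>\<^bsub>A\<^esub> f x y"
  using assms bilinear absorb
  by (intro S.biadditive_rcos_cong) (simp_all add: bilinear_op_def)

text \<open>Every element lies in its own coset, so equal cosets make one representative a member of
  the other's coset, as \<open>rcos_op_cong\<close> requires.\<close>

lemma op_well_defined:
  assumes "x \<in> carrier A" "x' \<in> carrier A" "y \<in> carrier A" "y' \<in> carrier A"
    and "I +>\<^bsub>A\<^esub> x = I +>\<^bsub>A\<^esub> x'" "I +>\<^bsub>A\<^esub> y = I +>\<^bsub>A\<^esub> y'"
  shows "I +>\<^bsub>A\<^esub> f x y = I +>\<^bsub>A\<^esub> f x' y'"
  using assms by (metis rcos_op_cong S.a_rcos_self)

lemma coset_op_rcos:
  assumes "x \<in> carrier A" "y \<in> carrier A"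
  shows "coset_op A I f (I +>\<^bsub>A\<^esub> x) (I +>\<^bsub>A\<^esub> y) = I +>\<^bsub>A\<^esub> f x y"
  unfolding coset_op_def
  using assms by (intro S.UN_rcos_const rcos_op_cong)

lemma bilinear_coset_op: "bilinear_op K (quotient_trialgebra A I) (coset_op A I f)"
proof -
  have A: "module K A" "submodule I K A" by unfold_locales
  show ?thesis
    using bilinear
    by (auto simp: bilinear_op_def carrier_quotient_trialgebra quotient_trialgebra_add[OF A]
        quotient_trialgebra_smult[OF A] coset_op_rcos)
qed

end

theorem proposition2p1:
  fixes K :: "('k, 'r) ring_scheme"
    and A :: "('k, 'a, 'm) trialgebra_scheme"
    and I :: "'a set"
  assumes "triassociative_algebra K A"
    and "tri_ideal I K A"
  shows "let Q = quotient_trialgebra A I in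
    (\<forall>x\<in>carrier A. \<forall>x'\<in>carrier A. \<forall>y\<in>carrier A. \<forall>y'\<in>carrier A.
       I +>\<^bsub>A\<^esub> x = I +>\<^bsub>A\<^esub> x' \<and> I +>\<^bsub>A\<^esub> y = I +>\<^bsub>A\<^esub> y' \<longrightarrow>
         I +>\<^bsub>A\<^esub> (x \<stileturn>\<^bsub>A\<^esub> y) = I +>\<^bsub>A\<^esub> (x' \<stileturn>\<^bsub>A\<^esub> y') \<and>
         I +>\<^bsub>A\<^esub> (x \<bottom>\<^bsub>A\<^esub> y) = I +>\<^bsub>A\<^esub> (x' \<bottom>\<^bsub>A\<^esub> y') \<and>
         I +>\<^bsub>A\<^esub> (x \<turnstile>\<^bsub>A\<^esub> y) = I +>\<^bsub>A\<^esub> (x' \<turnstile>\<^bsub>A\<^esub> y')) \<and>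
    (\<forall>x\<in>carrier A. \<forall>y\<in>carrier A.
       (I +>\<^bsub>A\<^esub> x) \<stileturn>\<^bsub>Q\<^esub> (I +>\<^bsub>A\<^esub> y) = I +>\<^bsub>A\<^esub> (x \<stileturn>\<^bsub>A\<^esub> y) \<and>
       (I +>\<^bsub>A\<^esub> x) \<bottom>\<^bsub>Q\<^esub> (I +>\<^bsub>A\<^esub> y) = I +>\<^bsub>A\<^esub> (x \<bottom>\<^bsub>A\<^esub> y) \<and>
       (I +>\<^bsub>A\<^esub> x) \<turnstile>\<^bsub>Q\<^esub> (I +>\<^bsub>A\<^esub> y) = I +>\<^bsub>A\<^esub> (x \<turnstile>\<^bsub>A\<^esub> y)) \<and>
    triassociative_algebra K Q"
proof -
  interpret triassociative_algebra K A by fact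
  interpret tri_ideal I K A by fact
  have A: "module K A" "submodule I K A" by unfold_locales
  interpret l: ideal_op K A I "(\<stileturn>\<^bsub>A\<^esub>)"
    using bilinear_lprod lprod_absorb by unfold_locales
  interpret m: ideal_op K A I "(\<bottom>\<^bsub>A\<^esub>)"
    using bilinear_mprod mprod_absorb by unfold_locales
  interpret r: ideal_op K A I "(\<turnstile>\<^bsub>A\<^esub>)"
    using bilinear_rprod rprod_absorb by unfold_locales
  have "triassociative_algebra_axioms K (quotient_trialgebra A I)"
    unfolding triassociative_algebra_axioms_def quotient_trialgebra_simps(5-7)
    using l.bilinear_coset_op m.bilinear_coset_op r.bilinear_coset_op
    \<comment> \<open>\<open>tri1\<close>, \<open>tri4\<close> and \<open>tri5\<close> share their
      left-hand side. Reversing the last two lets all three rewrite to the one normal form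
      \<open>x \<stileturn> (y \<stileturn> z)\<close>.\<close>
    by (auto simp: carrier_quotient_trialgebra l.coset_op_rcos m.coset_op_rcos r.coset_op_rcos
        l.op_closed m.op_closed r.op_closed
        tri1 tri2 tri3 tri4[symmetric] tri5[symmetric] tri6 tri7 tri8 tri9 tri10 tri11)
  then have Q: "triassociative_algebra K (quotient_trialgebra A I)"
    using module_quotient_trialgebra[OF A] field_axioms
    by (intro triassociative_algebra.intro)
  show ?thesis
    unfolding Let_def quotient_trialgebra_simps(5-7)
    \<comment> \<open>\<open>Q\<close> settles the last conjunct; each other goal is
      well-definedness or the coset formula for one of the products.\<close>
    by (intro conjI ballI impI Q; (elim conjE)?;
        rule l.op_well_defined m.op_well_defined r.op_well_defined
          l.coset_op_rcos m.coset_op_rcos r.coset_op_rcos; assumption)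
qed

end
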